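(* Let $G$ be a fundamental FHM-graph and let $\Pi_1,\dots,\Pi_p$ be all the (unordered) pairs of disjoint odd cycles of $G$. Suppose there is a choice of edges $b^1,\dots,b^p$ such that $b^i$ is a bridge of $\Pi_i$ for each $i$, satisfying: for each $i$, the even closed walk $E_i$ of $b^i$ in $\Pi_i$ contains at most $2$ edges belonging to $\{b^1,\dots,b^p\}\setminus\{b^i\}$, and the number of indices $i$ for which $E_i$ contains exactly $2$ edges of $\{b^1,\dots,b^p\}\setminus\{b^i\}$ is at most $2$. Then the edge polytope $P_G$ possesses a regular unimodular triangulation.
   Context: All graphs are finite, connected and simple (no loops, no multiple edges). Let $G$ have vertex set $\{1,\dots,d\}$ and edge set $E=\{e_1,\dots,e_n\}$. For an edge $e=\{i,j\}$ put $\rho(e)=\mathbf e_i+\mathbf e_j\in\mathbb Z^d$, where $\mathbf e_i$ is the $i$-th unit vector; the edge polytope $P_G\subset\mathbb R^d$ is the convex hull of $\{\rho(e): e\in E\}$. A regular unimodular triangulation of $P_G$ is a triangulation of $P_G$ by lattice simplices with vertices among the $\rho(e)$, all of normalized volume $1$, induced by a height function (lifting). Two odd cycles are disjoint if they have no common vertex. A bridge of a pair $(C,C')$ of disjoint odd cycles is an edge of $G$ with one endpoint on $C$ and the other on $C'$. An FHM-graph is a graph in which every pair of disjoint odd cycles has a bridge; a fundamental FHM-graph is an FHM-graph having at least one pair of disjoint odd cycles. For a bridge $b=\{u,v\}$ of $(C,C')$ with $u\in C$, $v\in C'$, the even closed walk of $b$ in $(C,C')$ is the closed walk obtained by traversing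 $C$ once starting and ending at $u$, then $b$ from $u$ to $v$, then traversing $C'$ once starting and ending at $v$, then $b$ back from $v$ to $u$. An edge is contained in the walk if it occurs in it. *)

theory Defs
  imports "HOL-Analysis.Analysis"
begin

text \<open>Graphs: the vertex set is the finite type 'n (so d = CARD('n) and R^d = real^'n);
  a simple graph is a set E of 2-element vertex sets.\<close>

definition simple_graph :: "'n set set \<Rightarrow> bool" where
  "simple_graph E \<longleftrightarrow> (\<forall>e\<in>E. card e = 2)"

definition adj_rel :: "'n set set \<Rightarrow> ('n \<times> 'n) set" where
  "adj_rel E = {(u, v). {u, v} \<in> E}"

definition connected_graph :: "'n set set \<Rightarrow> bool" where
  "connected_graph E \<longleftrightarrow> (\<forall>u v. (u, v) \<in> (adj_rel E)\<^sup>*)"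

text \<open>A cycle of the graph, represented by its edge set: distinct vertices
  v_0,...,v_{k-1}, k >= 3, with edges {v_i, v_{i+1 mod k}}.\<close>

definition cycle_of :: "'n set set \<Rightarrow> 'n set set \<Rightarrow> bool" where
  "cycle_of E C \<longleftrightarrow> C \<subseteq> E \<and>
     (\<exists>vs. distinct vs \<and> length vs \<ge> 3 \<and>
        C = {{vs ! i, vs ! ((i + 1) mod length vs)} | i. i < length vs})"

definition odd_cycle :: "'n set set \<Rightarrow> 'n set set \<Rightarrow> bool" where
  "odd_cycle E C \<longleftrightarrow> cycle_of E C \<and> odd (card C)"

definition cycle_verts :: "'n set set \<Rightarrow> 'n set" where
  "cycle_verts C = \<Union>C"

text \<open>The unordered pairs of disjoint odd cycles.\<close>

definition odd_pairs :: "'n set set \<Rightarrow> 'n set set set set" where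
  "odd_pairs E = {{C, C'} | C C'. odd_cycle E C \<and> odd_cycle E C' \<and>
                     cycle_verts C \<inter> cycle_verts C' = {}}"

definition is_bridge :: "'n set set \<Rightarrow> 'n set set set \<Rightarrow> 'n set \<Rightarrow> bool" where
  "is_bridge E Pr b \<longleftrightarrow> b \<in> E \<and>
     (\<exists>C C' u v. Pr = {C, C'} \<and> u \<in> cycle_verts C \<and> v \<in> cycle_verts C' \<and> b = {u, v})"

definition FHM_graph :: "'n set set \<Rightarrow> bool" where
  "FHM_graph E \<longleftrightarrow> (\<forall>Pr\<in>odd_pairs E. \<exists>b. is_bridge E Pr b)"

definition fundamental_FHM :: "'n set set \<Rightarrow> bool" where
  "fundamental_FHM E \<longleftrightarrow> FHM_graph E \<and> odd_pairs E \<noteq> {}"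

text \<open>Set of edges occurring in the even closed walk of bridge b in the pair Pr:
  all edges of both cycles plus b.\<close>

definition walk_edges :: "'n set set set \<Rightarrow> 'n set \<Rightarrow> 'n set set" where
  "walk_edges Pr b = insert b (\<Union>Pr)"

text \<open>Edge polytope.\<close>

definition rho :: "'n::finite set \<Rightarrow> real ^ 'n" where
  "rho e = (\<chi> i. if i \<in> e then 1 else 0)"

definition edge_polytope :: "'n::finite set set \<Rightarrow> (real ^ 'n) set" where
  "edge_polytope E = convex hull (rho ` E)"

text \<open>Triangulations of conv A by lattice simplices with vertices in A, given by the
  vertex sets of the maximal simplices.\<close>

definition integral_point :: "real ^ 'n \<Rightarrow> bool" where
  "integral_point z \<longleftrightarrow> (\<forall>i. z $ i \<in> \<int>)"

definition triangulation :: "(real ^ 'n) set \<Rightarrow> (real ^ 'n) set set \<Rightarrow> bool" where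
  "triangulation A T \<longleftrightarrow> finite T \<and>
     (\<forall>S\<in>T. S \<subseteq> A \<and> \<not> affine_dependent S \<and>
             aff_dim (convex hull S) = aff_dim (convex hull A)) \<and>
     \<Union>((\<lambda>S. convex hull S) ` T) = convex hull A \<and>
     (\<forall>S\<in>T. \<forall>S'\<in>T. (convex hull S \<inter> convex hull S') face_of (convex hull S) \<and>
                      (convex hull S \<inter> convex hull S') face_of (convex hull S'))"

text \<open>Normalized volume 1: the vertices form an affine lattice basis of
  Z^d intersected with the affine hull of the simplex.\<close>

definition unimodular_simplex :: "(real ^ 'n) set \<Rightarrow> bool" where
  "unimodular_simplex S \<longleftrightarrow>
     (\<forall>z. integral_point z \<and> z \<in> affine hull S \<longrightarrow>
        (\<exists>c :: real ^ 'n \<Rightarrow> int. sum c S = 1 \<and> (\<Sum>v\<in>S. of_int (c v) *\<^sub>R v) = z))"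

text \<open>Regularity: induced by a height function w on A, i.e. for each maximal simplex S
  some affine function agrees with w on S and is strictly below w on A - S.\<close>

definition regular_triangulation :: "(real ^ 'n) set \<Rightarrow> (real ^ 'n) set set \<Rightarrow> bool" where
  "regular_triangulation A T \<longleftrightarrow> triangulation A T \<and>
     (\<exists>w :: real ^ 'n \<Rightarrow> real. \<forall>S\<in>T. \<exists>a :: real ^ 'n. \<exists>a0 :: real.
        (\<forall>x\<in>S. a \<bullet> x + a0 = w x) \<and> (\<forall>x\<in>A - S. a \<bullet> x + a0 < w x))"

definition has_regular_unimodular_triangulation :: "'n::finite set set \<Rightarrow> bool" where
  "has_regular_unimodular_triangulation E \<longleftrightarrow>
     (\<exists>T. regular_triangulation (rho ` E) T \<and> (\<forall>S\<in>T. unimodular_simplex S))"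

end

(* Put weight -x on the chosen bridges and 0 on all other edges, where x = 3/2 on bridges whose
   closed walk contains exactly two other chosen bridges and x = 1 on the rest, and perturb
   generically. The lower hull of the edge vectors lifted to these heights gives a regular
   triangulation. If a cell contained two disjoint odd cycles C and C', with bridge {u, v}, then
   traversing each cycle from the endpoint of the bridge would give
     2 rho {u, v} = (alternating sum of rho over C) + (alternating sum of rho over C'),
   and the right-hand side would be lifted strictly above the left-hand side, contradicting that
   C and C' lie on a common lower face. So any two odd cycles of a cell meet; since cells span
   R^d, every vertex then has an odd walk to every other one inside the cell, and the edge
   vectors generate all integer vectors with even coordinate sum. *)

theory Submission
  imports Defs
begin

section \<open>Generic heights\<close>

text \<open>Perturb by powers of one parameter t. If a functional matched \<open>w\<close> on a
  dependent \<open>D\<close>, a linear relation on \<open>D\<close> would annihilate the heights, so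
  t would be a root of a nonzero polynomial. There are finitely many such polynomials, so some small
  t avoids all roots.\<close>

lemma generic_height:
  fixes A :: "'a::euclidean_space set" and w0 :: "'a \<Rightarrow> real"
  assumes "finite A" "\<delta> > 0"
  obtains w where "\<forall>v\<in>A. \<bar>w v - w0 v\<bar> < \<delta>"
    "\<And>D a. D \<subseteq> A \<Longrightarrow> \<forall>v\<in>D. a \<bullet> v = w v \<Longrightarrow> independent D"
proof -
  obtain idx :: "'a \<Rightarrow> nat" where idx: "inj_on idx A"
    using finite_imp_inj_to_nat_seg[OF \<open>finite A\<close>] by blast
  define DD where "DD = {D. D \<subseteq> A \<and> dependent D}"
  have "finite DD"
    using \<open>finite A\<close> by (simp add: DD_def)
  have "\<forall>D\<in>DD. \<exists>l. (\<exists>v\<in>D. l v \<noteq> 0) \<and> (\<Sum>v\<in>D. l v *\<^sub>R v) = 0"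
    using \<open>finite A\<close> by (auto simp: DD_def dependent_finite dest: finite_subset)
  then obtain l where l: "\<And>D. D \<in> DD \<Longrightarrow> \<exists>v\<in>D. l D v \<noteq> 0"
      "\<And>D. D \<in> DD \<Longrightarrow> (\<Sum>v\<in>D. l D v *\<^sub>R v) = 0"
    by metis
  \<comment> \<open>The value at t is the relation \<open>l D\<close> paired with the perturbed
    heights. The exponents start at 1, so the constant term from \<open>w0\<close> cannot cancel a
    coefficient of the perturbation.\<close>
  define p where "p D = [:\<Sum>v\<in>D. l D v * w0 v:] + (\<Sum>v\<in>D. monom (l D v) (Suc (idx v)))" for D
  have "p D \<noteq> 0" if D: "D \<in> DD" for D
  proof -
    obtain v where v: "v \<in> D" "l D v \<noteq> 0"
      using l(1)[OF D] by blast
    have DA: "D \<subseteq> A" and "finite D"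
      using D \<open>finite A\<close> by (auto simp: DD_def dest: finite_subset)
    have "idx u = idx v \<longleftrightarrow> u = v" if "u \<in> D" for u
      using idx DA v that by (auto simp: inj_on_def)
    then have "coeff (p D) (Suc (idx v)) = (\<Sum>u\<in>D. if u = v then l D v else 0)"
      by (auto simp: p_def coeff_add coeff_sum intro!: sum.cong)
    also have "\<dots> = l D v"
      using v \<open>finite D\<close> by simp
    finally show ?thesis
      using v by auto
  qed
  then have "finite (\<Union>D\<in>DD. {t. poly (p D) t = 0})"
    using \<open>finite DD\<close> by (auto intro: poly_roots_finite)
  \<comment> \<open>The bound 1 on t makes every positive power of t at most t, hence below
    \<delta>.\<close>
  moreover have "infinite {0<..<min 1 \<delta>}"
    using \<open>\<delta> > 0\<close> by (intro infinite_Ioo) auto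
  ultimately have "{0<..<min 1 \<delta>} - (\<Union>D\<in>DD. {t. poly (p D) t = 0}) \<noteq> {}"
    by (metis Diff_infinite_finite finite.emptyI)
  then obtain t where "t \<in> {0<..<min 1 \<delta>} - (\<Union>D\<in>DD. {t. poly (p D) t = 0})"
    by blast
  then have t: "0 < t" "t < 1" "t < \<delta>" "\<And>D. D \<in> DD \<Longrightarrow> poly (p D) t \<noteq> 0"
    by auto
  define w where "w v = w0 v + t ^ Suc (idx v)" for v
  show thesis
  proof
    have "t ^ Suc (idx v) \<le> t" for v
      using t power_decreasing[of 1 "Suc (idx v)" t] by simp
    then have "t ^ Suc (idx v) < \<delta>" for v
      using t(3) by (rule le_less_trans)
    then show "\<forall>v\<in>A. \<bar>w v - w0 v\<bar> < \<delta>"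
      using t(1) by (simp add: w_def del: power_Suc)
  next
    fix D a
    assume D: "D \<subseteq> A" and a: "\<forall>v\<in>D. a \<bullet> v = w v"
    show "independent D"
    proof (rule ccontr)
      assume "\<not> independent D"
      with D have "D \<in> DD"
        by (simp add: DD_def)
      have "poly (p D) t = (\<Sum>v\<in>D. l D v * w v)"
        by (simp add: p_def w_def poly_sum poly_monom sum.distrib distrib_left)
      also have "\<dots> = a \<bullet> (\<Sum>v\<in>D. l D v *\<^sub>R v)"
        by (simp add: inner_sum_right a)
      finally show False
        using l(2)[OF \<open>D \<in> DD\<close>] t(4)[OF \<open>D \<in> DD\<close>] by simp
    qed
  qed
qed

section \<open>Regular triangulations from generic heights\<close>

text \<open>Linear functionals suffice in place of affine ones: the point sets below lie in a
  hyperplane \<open>h \<bullet> v = 1\<close>, where a constant term can be absorbed into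
  \<open>a\<close>.\<close>

definition dual_feasible :: "'a::real_inner set \<Rightarrow> ('a \<Rightarrow> real) \<Rightarrow> 'a set" where
  "dual_feasible A w = {a. \<forall>v\<in>A. a \<bullet> v \<le> w v}"

definition tight :: "'a::real_inner set \<Rightarrow> ('a \<Rightarrow> real) \<Rightarrow> 'a \<Rightarrow> 'a set" where
  "tight A w a = {v \<in> A. a \<bullet> v = w v}"

text \<open>Spanning selects the full-dimensional cells; it says that \<open>a\<close> is a vertex
  of the dual polyhedron.\<close>

definition lower_cells :: "'a::real_inner set \<Rightarrow> ('a \<Rightarrow> real) \<Rightarrow> 'a set set" where
  "lower_cells A w = {tight A w a | a. a \<in> dual_feasible A w \<and> span (tight A w a) = UNIV}"

text \<open>Tight constraints cannot break along \<open>y\<close>, and each of the finitely many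
  slack ones survives for small \<epsilon>.\<close>

lemma dual_feasible_direction:
  assumes "finite A" "a \<in> dual_feasible A w" "\<And>v. v \<in> tight A w a \<Longrightarrow> y \<bullet> v \<le> 0"
  shows "\<exists>\<epsilon>>0. a + \<epsilon> *\<^sub>R y \<in> dual_feasible A w"
proof -
  have "\<forall>v\<in>A. \<forall>\<^sub>F \<epsilon> in at_right 0. (a + \<epsilon> *\<^sub>R y) \<bullet> v \<le> w v"
  proof
    fix v assume "v \<in> A"
    show "\<forall>\<^sub>F \<epsilon> in at_right 0. (a + \<epsilon> *\<^sub>R y) \<bullet> v \<le> w v"
    proof (cases "v \<in> tight A w a")
      case True
      then have "(a + \<epsilon> *\<^sub>R y) \<bullet> v \<le> w v" if "\<epsilon> > 0" for \<epsilon>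
        using assms(3)[OF True] that
        by (simp add: tight_def inner_add_left mult_nonneg_nonpos)
      then show ?thesis
        by (intro eventually_at_rightI[of 0 1]) auto
    next
      case False
      then have "a \<bullet> v < w v"
        using \<open>v \<in> A\<close> assms(2) by (auto simp: tight_def dual_feasible_def less_le)
      moreover have "((\<lambda>\<epsilon>. (a + \<epsilon> *\<^sub>R y) \<bullet> v) \<longlongrightarrow> (a + 0 *\<^sub>R y) \<bullet> v) (at_right 0)"
        by (intro tendsto_intros)
      ultimately have "\<forall>\<^sub>F \<epsilon> in at_right 0. (a + \<epsilon> *\<^sub>R y) \<bullet> v < w v"
        by (intro order_tendstoD) auto
      then show ?thesis
        by eventually_elim simp
    qed
  qed
  then have "\<forall>\<^sub>F \<epsilon> in at_right 0. \<forall>v\<in>A. (a + \<epsilon> *\<^sub>R y) \<bullet> v \<le> w v"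
    using \<open>finite A\<close> by (simp add: eventually_ball_finite_distrib)
  moreover have "\<forall>\<^sub>F \<epsilon> in at_right 0. (0::real) < \<epsilon>"
    by (simp add: eventually_at_right_less)
  ultimately have "\<forall>\<^sub>F \<epsilon> in at_right 0. 0 < \<epsilon> \<and> (\<forall>v\<in>A. (a + \<epsilon> *\<^sub>R y) \<bullet> v \<le> w v)"
    by eventually_elim simp
  then show ?thesis
    by (auto simp: dual_feasible_def dest!: eventually_happens)
qed

text \<open>Bounds pass from spanning vectors to their linear combinations, in particular to the
  standard basis.\<close>

lemma bounded_inner_spanning:
  fixes A :: "'a::euclidean_space set"
  assumes "span A = UNIV" and bd: "\<And>v. v \<in> A \<Longrightarrow> \<exists>B. \<forall>a\<in>K. \<bar>a \<bullet> v\<bar> \<le> B"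
  shows "bounded K"
proof -
  have ex: "\<exists>B. \<forall>a\<in>K. \<bar>a \<bullet> x\<bar> \<le> B" for x
  proof -
    have "x \<in> span A"
      using assms(1) by simp
    then show ?thesis
    proof (induction rule: span_induct_alt)
      case base
      show ?case
        by (intro exI[of _ 0]) simp
    next
      case (step c v y)
      obtain B1 where B1: "\<forall>a\<in>K. \<bar>a \<bullet> v\<bar> \<le> B1"
        using bd[OF step(1)] by blast
      obtain B2 where B2: "\<forall>a\<in>K. \<bar>a \<bullet> y\<bar> \<le> B2"
        using step(2) by blast
      have "\<bar>a \<bullet> (c *\<^sub>R v + y)\<bar> \<le> \<bar>c\<bar> * B1 + B2" if "a \<in> K" for a
      proof -
        have "\<bar>a \<bullet> (c *\<^sub>R v + y)\<bar> \<le> \<bar>c\<bar> * \<bar>a \<bullet> v\<bar> + \<bar>a \<bullet> y\<bar>"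
          by (simp add: inner_add_right abs_mult[symmetric] abs_triangle_ineq)
        also have "\<dots> \<le> \<bar>c\<bar> * B1 + B2"
          using B1 B2 that by (intro add_mono mult_left_mono) auto
        finally show ?thesis .
      qed
      then show ?case
        by blast
    qed
  qed
  then obtain B where B: "\<And>x a. a \<in> K \<Longrightarrow> \<bar>a \<bullet> x\<bar> \<le> B x"
    by metis
  have "norm a \<le> (\<Sum>i\<in>Basis. B i)" if "a \<in> K" for a
    using norm_le_l1[of a] by (rule order_trans) (intro sum_mono B[OF that])
  then show ?thesis
    by (auto simp: bounded_iff)
qed

text \<open>A vertex of the face of optimal solutions of the linear program dual to lifting \<open>x\<close> to the
  lower hull: optimality puts \<open>x\<close> into the hull of the tight points, and being a vertex makes
  the tight points spanning. Positivity of all coefficients bounds the optimal face.\<close>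

lemma lower_cells_cover_interior:
  fixes A :: "'a::euclidean_space set"
  assumes fin: "finite A" and span: "span A = UNIV" and h: "\<And>v. v \<in> A \<Longrightarrow> h \<bullet> v = 1"
    and pos: "\<And>v. v \<in> A \<Longrightarrow> c v > 0" and c1: "sum c A = 1"
  shows "\<exists>S\<in>lower_cells A w. (\<Sum>v\<in>A. c v *\<^sub>R v) \<in> convex hull S"
proof -
  define x where "x = (\<Sum>v\<in>A. c v *\<^sub>R v)"
  have ax: "a \<bullet> x = (\<Sum>v\<in>A. c v * (a \<bullet> v))" for a
    by (simp add: x_def inner_sum_right)
  have hx: "h \<bullet> x = 1"
    using c1 h by (simp add: ax)
  define Q where "Q = dual_feasible A w"
  have closedQ: "closed Q"
  proof -
    have "Q = (\<Inter>v\<in>A. {a. a \<bullet> v \<le> w v})"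
      by (auto simp: Q_def dual_feasible_def)
    then show ?thesis
      by (auto intro!: closed_Collect_le continuous_intros)
  qed
  have convexQ: "convex Q"
  proof -
    have "Q = (\<Inter>v\<in>A. {a. v \<bullet> a \<le> w v})"
      by (auto simp: Q_def dual_feasible_def inner_commute)
    then show ?thesis
      by (auto intro!: convex_INT convex_halfspace_le)
  qed
  \<comment> \<open>A multiple of \<open>h\<close> is constant on \<open>A\<close>, so a lower bound
    of the heights gives a feasible point. The inserted 0 keeps \<open>Min\<close> defined on an
    empty set.\<close>
  define a0 where "a0 = Min (insert 0 (w ` A)) *\<^sub>R h"
  have "a0 \<in> Q"
    using h fin by (auto simp: Q_def dual_feasible_def a0_def)
  define K where "K = {a \<in> Q. a0 \<bullet> x \<le> a \<bullet> x}"
  have "bounded K"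
  proof (rule bounded_inner_spanning[OF span])
    fix v assume v: "v \<in> A"
    define M where "M = (\<Sum>u\<in>A - {v}. c u * w u)"
    have "\<bar>a \<bullet> v\<bar> \<le> \<bar>w v\<bar> + \<bar>(a0 \<bullet> x - M) / c v\<bar>" if a: "a \<in> K" for a
    proof -
      have aw: "a \<bullet> u \<le> w u" if "u \<in> A" for u
        using a that by (simp add: K_def Q_def dual_feasible_def)
      \<comment> \<open>Feasibility bounds \<open>a \<bullet> v\<close> from above. From below, the
        objective is at least its value at \<open>a0\<close> while all other points contribute at
        most \<open>M\<close>; dividing by \<open>c v > 0\<close> isolates
        \<open>a \<bullet> v\<close>.\<close>
      have "a0 \<bullet> x \<le> c v * (a \<bullet> v) + (\<Sum>u\<in>A - {v}. c u * (a \<bullet> u))"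
        using a v fin by (simp add: K_def ax sum.remove[of A v "\<lambda>v. c v * (a \<bullet> v)"])
      also have "\<dots> \<le> c v * (a \<bullet> v) + M"
        unfolding M_def using pos aw
        by (intro add_left_mono sum_mono mult_left_mono) (auto simp: less_imp_le)
      finally have "(a0 \<bullet> x - M) / c v \<le> a \<bullet> v"
        using pos[OF v] by (simp add: field_simps)
      with aw[OF v] show ?thesis
        by linarith
    qed
    then show "\<exists>B. \<forall>a\<in>K. \<bar>a \<bullet> v\<bar> \<le> B"
      by blast
  qed
  moreover have "closed K"
  proof -
    have "K = Q \<inter> {a. a0 \<bullet> x \<le> a \<bullet> x}"
      by (auto simp: K_def)
    then show ?thesis
      using closedQ by (auto intro!: closed_Int closed_Collect_le continuous_intros)
  qed
  ultimately have "compact K"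
    by (simp add: compact_eq_bounded_closed)
  moreover have "a0 \<in> K"
    using \<open>a0 \<in> Q\<close> by (simp add: K_def)
  ultimately obtain a1 where a1: "a1 \<in> K" "\<And>a. a \<in> K \<Longrightarrow> a \<bullet> x \<le> a1 \<bullet> x"
    using continuous_attains_sup[of K "\<lambda>a. a \<bullet> x"] by (force intro!: continuous_intros)
  have opt: "a \<bullet> x \<le> a1 \<bullet> x" if "a \<in> Q" for a
    using that a1 by (cases "a \<in> K") (auto simp: K_def)
  define F where "F = K \<inter> {a. x \<bullet> a = a1 \<bullet> x}"
  have F_eq: "F = Q \<inter> {a. x \<bullet> a = a1 \<bullet> x}"
    using a1 by (auto simp: F_def K_def inner_commute)
  have "compact F"
    unfolding F_def using \<open>compact K\<close> by (intro compact_Int_closed closed_hyperplane)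
  moreover have "convex F"
    unfolding F_eq using convexQ by (intro convex_Int convex_hyperplane)
  moreover have "F \<noteq> {}"
    using a1 by (auto simp: F_def inner_commute)
  ultimately obtain a where a: "a extreme_point_of F"
    using extreme_point_exists_convex by blast
  then have aQ: "a \<in> Q" and a_opt: "a \<bullet> x = a1 \<bullet> x"
    by (auto simp: extreme_point_of_def F_eq inner_commute)
  let ?S = "tight A w a"
  have finS: "finite ?S"
    using fin by (simp add: tight_def)
  have x_in: "x \<in> convex hull ?S"
  proof (rule ccontr)
    assume "x \<notin> convex hull ?S"
    moreover have "closed (convex hull ?S)"
      using finS by (simp add: compact_imp_closed finite_imp_compact_convex_hull)
    ultimately obtain y \<beta> where y: "y \<bullet> x < \<beta>" "\<And>z. z \<in> convex hull ?S \<Longrightarrow> y \<bullet> z > \<beta>"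
      using separating_hyperplane_closed_point[of "convex hull ?S" x] by auto
    \<comment> \<open>Since \<open>h\<close> is 1 on the tight points and at \<open>x\<close>, this
      turns the separating hyperplane into a linear direction that is nonpositive on tight points
      but positive at \<open>x\<close>: moving along it stays feasible and improves the
      optimum.\<close>
    define y' where "y' = \<beta> *\<^sub>R h - y"
    have "y' \<bullet> v \<le> 0" if "v \<in> ?S" for v
      using y(2)[OF hull_inc[OF that]] h[of v] that
      by (simp add: y'_def inner_diff_left tight_def)
    then obtain \<epsilon> where \<epsilon>: "\<epsilon> > 0" "a + \<epsilon> *\<^sub>R y' \<in> Q"
      using dual_feasible_direction[OF fin, of a w y'] aQ unfolding Q_def by blast
    have "y' \<bullet> x > 0"
      using y(1) hx by (simp add: y'_def inner_diff_left)
    then have "(a + \<epsilon> *\<^sub>R y') \<bullet> x > a \<bullet> x"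
      using \<epsilon> by (simp add: inner_add_left)
    with opt[OF \<epsilon>(2)] a_opt show False
      by simp
  qed
  have "span ?S = UNIV"
  proof (rule ccontr)
    assume "span ?S \<noteq> UNIV"
    \<comment> \<open>Orthogonal to all tight points, \<open>y\<close> is also orthogonal to
      \<open>x\<close> in their hull. So \<open>a\<close> can move both ways along \<open>y\<close>
      inside the optimal face, against extremality.\<close>
    then obtain y where y: "y \<noteq> 0" "\<And>v. v \<in> span ?S \<Longrightarrow> y \<bullet> v = 0"
      using span_not_UNIV_orthogonal by blast
    have "x \<in> span ?S"
      using x_in convex_hull_subset_span by blast
    then have yx: "y \<bullet> x = 0"
      by (rule y(2))
    have yS: "y \<bullet> v = 0" if "v \<in> ?S" for v
      using that by (intro y(2) span_base)
    obtain \<epsilon>1 where e1: "\<epsilon>1 > 0" "a + \<epsilon>1 *\<^sub>R y \<in> Q"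
      using dual_feasible_direction[OF fin, of a w y] aQ yS unfolding Q_def by auto
    obtain \<epsilon>2 where e2: "\<epsilon>2 > 0" "a + \<epsilon>2 *\<^sub>R (- y) \<in> Q"
      using dual_feasible_direction[OF fin, of a w "- y"] aQ yS unfolding Q_def by auto
    have "a + \<epsilon>1 *\<^sub>R y \<in> F" "a - \<epsilon>2 *\<^sub>R y \<in> F"
      using e1 e2 yx a_opt
      by (auto simp: F_eq inner_add_right inner_diff_right inner_commute)
    moreover have "a \<in> open_segment (a + \<epsilon>1 *\<^sub>R y) (a - \<epsilon>2 *\<^sub>R y)"
    proof -
      have "a + \<epsilon>1 *\<^sub>R y \<noteq> a - \<epsilon>2 *\<^sub>R y"
      proof
        assume "a + \<epsilon>1 *\<^sub>R y = a - \<epsilon>2 *\<^sub>R y"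
        then have "(\<epsilon>1 + \<epsilon>2) *\<^sub>R y = 0"
          by (simp add: algebra_simps)
        with y e1 e2 show False
          by simp
      qed
      moreover have "a = (1 - \<epsilon>1 / (\<epsilon>1 + \<epsilon>2)) *\<^sub>R (a + \<epsilon>1 *\<^sub>R y)
          + (\<epsilon>1 / (\<epsilon>1 + \<epsilon>2)) *\<^sub>R (a - \<epsilon>2 *\<^sub>R y)"
      proof -
        have "(1 - \<epsilon>1 / (\<epsilon>1 + \<epsilon>2)) * \<epsilon>1 - \<epsilon>1 / (\<epsilon>1 + \<epsilon>2) * \<epsilon>2 = 0"
          using e1 e2 by (simp add: field_simps)
        then have "((1 - \<epsilon>1 / (\<epsilon>1 + \<epsilon>2)) * \<epsilon>1 - \<epsilon>1 / (\<epsilon>1 + \<epsilon>2) * \<epsilon>2) *\<^sub>R y = 0"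
          by simp
        then show ?thesis
          by (simp add: scaleR_add_right scaleR_diff_right scaleR_diff_left)
      qed
      moreover have "0 < \<epsilon>1 / (\<epsilon>1 + \<epsilon>2)" "\<epsilon>1 / (\<epsilon>1 + \<epsilon>2) < 1"
        using e1 e2 by auto
      ultimately show ?thesis
        unfolding in_segment by blast
    qed
    ultimately show False
      using a by (auto simp: extreme_point_of_def)
  qed
  then have "?S \<in> lower_cells A w"
    using aQ by (auto simp: lower_cells_def Q_def)
  with x_in show ?thesis
    unfolding x_def by blast
qed

lemma finite_lower_cells: "finite A \<Longrightarrow> finite (lower_cells A w)"
  by (rule finite_subset[of _ "Pow A"]) (auto simp: lower_cells_def tight_def)

text \<open>Moving slightly towards the barycentre of \<open>A\<close> makes all coefficients
  positive. The union of the cells is closed, so it also contains the limit point.\<close>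

lemma lower_cells_cover:
  fixes A :: "'a::euclidean_space set"
  assumes fin: "finite A" and span: "span A = UNIV" and h: "\<And>v. v \<in> A \<Longrightarrow> h \<bullet> v = 1"
  shows "(\<Union>S\<in>lower_cells A w. convex hull S) = convex hull A"
proof
  show "(\<Union>S\<in>lower_cells A w. convex hull S) \<subseteq> convex hull A"
    by (intro UN_least hull_mono) (auto simp: lower_cells_def tight_def)
next
  let ?U = "\<Union>S\<in>lower_cells A w. convex hull S"
  have "closed (convex hull S)" if "S \<in> lower_cells A w" for S
  proof -
    have "finite S"
      using that fin by (auto simp: lower_cells_def tight_def)
    then show ?thesis
      by (simp add: compact_imp_closed finite_imp_compact_convex_hull)
  qed
  then have closedU: "closed ?U"
    using finite_lower_cells[OF fin] by (intro closed_UN) auto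
  show "convex hull A \<subseteq> ?U"
  proof
    fix x assume "x \<in> convex hull A"
    then obtain c where c: "\<And>v. v \<in> A \<Longrightarrow> c v \<ge> 0" "sum c A = 1" "(\<Sum>v\<in>A. c v *\<^sub>R v) = x"
      by (auto simp: convex_hull_finite[OF fin])
    have "A \<noteq> {}"
      using c(2) by auto
    then have cardA: "real (card A) > 0"
      using fin by (simp add: card_gt_0_iff)
    define m where "m = (\<Sum>v\<in>A. (1 / card A) *\<^sub>R v)"
    have in_U: "(1 - t) *\<^sub>R x + t *\<^sub>R m \<in> ?U" if t: "0 < t" "t < 1" for t
    proof -
      define c' where "c' v = (1 - t) * c v + t * (1 / card A)" for v
      have "\<exists>S\<in>lower_cells A w. (\<Sum>v\<in>A. c' v *\<^sub>R v) \<in> convex hull S"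
      proof (rule lower_cells_cover_interior[OF fin span h])
        show "0 < c' v" if "v \<in> A" for v
          unfolding c'_def using t c(1)[OF that] cardA by (intro add_nonneg_pos) auto
        show "sum c' A = 1"
          using cardA c(2) by (simp add: c'_def sum.distrib sum_distrib_left[symmetric])
      qed
      moreover have "(\<Sum>v\<in>A. c' v *\<^sub>R v) = (1 - t) *\<^sub>R x + t *\<^sub>R m"
        by (simp add: c'_def m_def c(3)[symmetric] scaleR_add_left sum.distrib scaleR_sum_right)
      ultimately show ?thesis
        by auto
    qed
    have "((\<lambda>t. (1 - t) *\<^sub>R x + t *\<^sub>R m) \<longlongrightarrow> (1 - 0) *\<^sub>R x + 0 *\<^sub>R m) (at_right 0)"
      by (intro tendsto_intros)
    moreover have "\<forall>\<^sub>F t in at_right 0. (1 - t) *\<^sub>R x + t *\<^sub>R m \<in> ?U"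
      by (rule eventually_at_rightI[of 0 1]) (use in_U in auto)
    ultimately show "x \<in> ?U"
      using Lim_in_closed_set[OF closedU] by force
  qed
qed

text \<open>At a common point \<open>a\<close> and \<open>a'\<close> take the same value, as each
  dominates the other on its own cell. A convex combination over the first cell can then put weight
  only on points where \<open>a'\<close> is tight as well.\<close>

lemma hull_tight_Int:
  assumes fin: "finite A" and a: "a \<in> dual_feasible A w" and a': "a' \<in> dual_feasible A w"
  shows "convex hull tight A w a \<inter> convex hull tight A w a'
    = convex hull (tight A w a \<inter> tight A w a')"
proof
  show "convex hull (tight A w a \<inter> tight A w a') \<subseteq> convex hull tight A w a \<inter> convex hull tight A w a'"
    by (simp add: hull_mono)
next
  have val: "p \<bullet> x \<le> q \<bullet> x"
    if x: "x \<in> convex hull tight A w q" and p: "p \<in> dual_feasible A w" for p q x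
  proof -
    obtain c where c: "\<And>v. v \<in> tight A w q \<Longrightarrow> c v \<ge> 0" "(\<Sum>v\<in>tight A w q. c v *\<^sub>R v) = x"
      using x fin by (auto simp: convex_hull_finite tight_def)
    have "p \<bullet> x = (\<Sum>v\<in>tight A w q. c v * (p \<bullet> v))"
      by (simp add: c(2)[symmetric] inner_sum_right)
    also have "\<dots> \<le> (\<Sum>v\<in>tight A w q. c v * (q \<bullet> v))"
      using p c(1) by (intro sum_mono mult_left_mono) (auto simp: tight_def dual_feasible_def)
    also have "\<dots> = q \<bullet> x"
      by (simp add: c(2)[symmetric] inner_sum_right)
    finally show ?thesis .
  qed
  show "convex hull tight A w a \<inter> convex hull tight A w a' \<subseteq> convex hull (tight A w a \<inter> tight A w a')"
  proof safe
    fix x assume x: "x \<in> convex hull tight A w a" "x \<in> convex hull tight A w a'"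
    have finS: "finite (tight A w a)"
      using fin by (simp add: tight_def)
    obtain c where c: "\<And>v. v \<in> tight A w a \<Longrightarrow> c v \<ge> 0" "sum c (tight A w a) = 1"
        "(\<Sum>v\<in>tight A w a. c v *\<^sub>R v) = x"
      using x(1) finS by (auto simp: convex_hull_finite)
    have "a \<bullet> x = a' \<bullet> x"
      using val[OF x(1) a'] val[OF x(2) a] by simp
    then have "(\<Sum>v\<in>tight A w a. c v * (a \<bullet> v - a' \<bullet> v)) = 0"
      by (simp add: c(3)[symmetric] inner_sum_right right_diff_distrib sum_subtractf)
    moreover have "c v * (a \<bullet> v - a' \<bullet> v) \<ge> 0" if "v \<in> tight A w a" for v
      using c(1)[OF that] that a' by (auto simp: tight_def dual_feasible_def)
    ultimately have z: "c v * (a \<bullet> v - a' \<bullet> v) = 0" if "v \<in> tight A w a" for v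
      using that finS by (simp add: sum_nonneg_eq_0_iff)
    have zero: "c v = 0" if "v \<in> tight A w a - tight A w a \<inter> tight A w a'" for v
    proof -
      have "v \<in> tight A w a" "a \<bullet> v - a' \<bullet> v \<noteq> 0"
        using that by (auto simp: tight_def)
      with z show ?thesis
        by fastforce
    qed
    have "sum c (tight A w a \<inter> tight A w a') = 1"
      using c(2) zero finS by (subst sum.mono_neutral_left[of "tight A w a"]) auto
    moreover have "(\<Sum>v\<in>tight A w a \<inter> tight A w a'. c v *\<^sub>R v) = x"
      using c(3) zero finS by (subst sum.mono_neutral_left[of "tight A w a"]) auto
    ultimately show "x \<in> convex hull (tight A w a \<inter> tight A w a')"
      using c(1) finS by (auto simp: convex_hull_finite)
  qed
qed

text \<open>Pairing a linear combination with \<open>h\<close> shows that its coefficients sum to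
  1.\<close>

lemma subset_affine_hull_spanning:
  fixes S :: "'a::euclidean_space set"
  assumes "finite S" "span S = UNIV" "\<And>v. v \<in> S \<Longrightarrow> h \<bullet> v = 1" "h \<bullet> x = 1"
  shows "x \<in> affine hull S"
proof -
  have "x \<in> span S"
    using assms by simp
  then obtain c where c: "x = (\<Sum>v\<in>S. c v *\<^sub>R v)"
    using assms(1) by (auto simp: span_finite)
  have "sum c S = h \<bullet> x"
    using assms(3) by (simp add: c inner_sum_right)
  then show ?thesis
    using assms(1,4) c by (auto simp: affine_hull_finite)
qed

text \<open>Genericity makes each cell independent, so the hull of any subset of a cell is a face;
  two cells meet in the hull of their common points. The functional defining a cell witnesses
  regularity, with constant term 0.\<close>

theorem regular_triangulation_lower_cells:
  fixes A :: "(real ^ 'n) set"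
  assumes fin: "finite A" and span: "span A = UNIV" and h: "\<And>v. v \<in> A \<Longrightarrow> h \<bullet> v = 1"
    and gen: "\<And>D a. D \<subseteq> A \<Longrightarrow> \<forall>v\<in>D. a \<bullet> v = w v \<Longrightarrow> independent D"
  shows "regular_triangulation A (lower_cells A w)"
  unfolding regular_triangulation_def triangulation_def
proof (intro conjI ballI)
  show "finite (lower_cells A w)"
    by (rule finite_lower_cells[OF fin])
next
  fix S assume "S \<in> lower_cells A w"
  then obtain a where S: "S = tight A w a" and spS: "span S = UNIV"
    by (auto simp: lower_cells_def)
  show SA: "S \<subseteq> A"
    by (auto simp: S tight_def)
  show "\<not> affine_dependent S"
    using gen[OF SA, of a] affine_dependent_imp_dependent by (auto simp: S tight_def)
  have "A \<subseteq> affine hull S"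
    using subset_affine_hull_spanning[of S h] spS h SA finite_subset[OF SA fin] by blast
  then have "affine hull S = affine hull A"
    using SA by (metis hull_mono hull_minimal affine_affine_hull subset_antisym)
  then show "aff_dim (convex hull S) = aff_dim (convex hull A)"
    by (metis aff_dim_affine_hull aff_dim_convex_hull)
next
  show "(\<Union>S\<in>lower_cells A w. convex hull S) = convex hull A"
    by (rule lower_cells_cover[OF fin span h])
next
  have face: "convex hull S \<inter> convex hull S' face_of convex hull S"
    if cells: "S \<in> lower_cells A w" "S' \<in> lower_cells A w" for S S'
  proof -
    obtain a a' where S: "S = tight A w a" "S' = tight A w a'"
        "a \<in> dual_feasible A w" "a' \<in> dual_feasible A w"
      using cells unfolding lower_cells_def by blast
    have "S \<subseteq> A" "\<forall>v\<in>S. a \<bullet> v = w v"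
      unfolding S(1) tight_def by blast+
    then have "independent S"
      by (rule gen)
    then have "\<not> affine_dependent S"
      using affine_dependent_imp_dependent by blast
    moreover have "\<exists>c. c \<subseteq> S \<and> convex hull S \<inter> convex hull S' = convex hull c"
      unfolding S(1,2) using hull_tight_Int[OF fin S(3,4)] Int_lower1 by blast
    ultimately show ?thesis
      using face_of_convex_hull_affine_independent by blast
  qed
  fix S S' assume *: "S \<in> lower_cells A w" "S' \<in> lower_cells A w"
  show "convex hull S \<inter> convex hull S' face_of convex hull S"
    using * by (rule face)
  show "convex hull S \<inter> convex hull S' face_of convex hull S'"
    using face[OF *(2,1)] by (simp add: Int_commute)
next
  show "\<exists>w'. \<forall>S\<in>lower_cells A w. \<exists>a a0. (\<forall>x\<in>S. a \<bullet> x + a0 = w' x) \<and> (\<forall>x\<in>A - S. a \<bullet> x + a0 < w' x)"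
  proof (intro exI[of _ w] ballI)
    fix S assume "S \<in> lower_cells A w"
    then obtain a where "S = tight A w a" "a \<in> dual_feasible A w"
      unfolding lower_cells_def by blast
    then have "(\<forall>x\<in>S. a \<bullet> x + 0 = w x) \<and> (\<forall>x\<in>A - S. a \<bullet> x + 0 < w x)"
      by (auto simp: tight_def dual_feasible_def less_le)
    then show "\<exists>a a0. (\<forall>x\<in>S. a \<bullet> x + a0 = w x) \<and> (\<forall>x\<in>A - S. a \<bullet> x + a0 < w x)"
      by blast
  qed
qed


section \<open>Odd cycles and closed walks\<close>

lemma sym_adj_rel: "sym (adj_rel E)"
  by (auto simp: sym_def adj_rel_def insert_commute)

lemma relpow_sym:
  assumes "sym R" "(u, v) \<in> R ^^ k"
  shows "(v, u) \<in> R ^^ k"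
  using assms(2)
proof (induction k arbitrary: v)
  case (Suc k)
  then obtain y where "(u, y) \<in> R ^^ k" "(y, v) \<in> R"
    by auto
  then show ?case
    using Suc.IH assms(1) by (meson relpow_Suc_I2 symD)
qed simp

lemma relpow_trans: "(u, v) \<in> R ^^ j \<Longrightarrow> (v, x) \<in> R ^^ k \<Longrightarrow> (u, x) \<in> R ^^ (j + k)"
  by (auto simp: relpow_add)

lemma relpow_segment:
  assumes "\<forall>i<k. (f i, f (Suc i)) \<in> R" "i \<le> j" "j \<le> k"
  shows "(f i, f j) \<in> R ^^ (j - i)"
  unfolding relpow_fun_conv using assms by (intro exI[of _ "\<lambda>l. f (i + l)"]) auto

text \<open>Distinct indices with the same edge would be cyclic successors of each other, which
  forces length 2. Hence the number of edges equals the number of vertices.\<close>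

lemma inj_on_cycle_edges:
  assumes "distinct vs" "length vs \<ge> 3"
  shows "inj_on (\<lambda>i. {vs ! i, vs ! ((i + 1) mod length vs)}) {..<length vs}"
proof (rule inj_onI)
  fix i j
  assume ij: "i \<in> {..<length vs}" "j \<in> {..<length vs}"
    and eq: "{vs ! i, vs ! ((i + 1) mod length vs)} = {vs ! j, vs ! ((j + 1) mod length vs)}"
  have nth: "vs ! p = vs ! q \<longleftrightarrow> p = q" if "p < length vs" "q < length vs" for p q
    using assms(1) that by (simp add: nth_eq_iff_index_eq)
  have lt: "(p + 1) mod length vs < length vs" for p
    using assms(2) by (intro mod_less_divisor) linarith
  from eq have "i = j \<or> (i = (j + 1) mod length vs \<and> (i + 1) mod length vs = j)"
    using ij nth lt by (auto simp: doubleton_eq_iff)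
  then show "i = j"
    using ij assms(2) by (auto simp: mod_Suc split: if_splits)
qed

text \<open>Rotating the vertex list to start at \<open>u\<close> permutes the edges. Each edge is
  used once, so sums over \<open>C\<close> become sums along the walk.\<close>

lemma odd_cycle_closed_walk:
  assumes "odd_cycle E C" "u \<in> cycle_verts C"
  obtains f k where "odd k" "f 0 = u" "f k = u"
    "inj_on (\<lambda>i. {f i, f (Suc i)}) {..<k}" "C = (\<lambda>i. {f i, f (Suc i)}) ` {..<k}"
proof -
  obtain vs where vs: "distinct vs" "length vs \<ge> 3"
      "C = {{vs ! i, vs ! ((i + 1) mod length vs)} | i. i < length vs}"
    using assms(1) unfolding odd_cycle_def cycle_of_def by blast
  define n where "n = length vs"
  define e where "e i = {vs ! i, vs ! ((i + 1) mod n)}" for i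
  have n: "n \<ge> 3"
    using vs(2) by (simp add: n_def)
  have inj_e: "inj_on e {..<n}"
    using inj_on_cycle_edges[OF vs(1,2)] by (simp add: e_def[abs_def] n_def)
  have C: "C = e ` {..<n}"
    using vs(3) by (auto simp: e_def n_def)
  have "card C = n"
    using inj_e by (simp add: C card_image)
  then have "odd n"
    using assms(1) by (simp add: odd_cycle_def)
  have "(i + 1) mod n < n" for i
    using n by (intro mod_less_divisor) linarith
  then obtain m where m: "m < n" "u = vs ! m"
    using assms(2) by (auto simp: cycle_verts_def C e_def)
  define s where "s i = (m + i) mod n" for i
  have inj_s: "inj_on s {..<n}"
  proof (rule inj_onI)
    fix i j assume "i \<in> {..<n}" "j \<in> {..<n}" "s i = s j"
    then show "i = j"
      using m(1) by (auto simp: s_def mod_if split: if_splits)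
  qed
  have "s ` {..<n} \<subseteq> {..<n}"
    using n by (auto simp: s_def)
  then have im_s: "s ` {..<n} = {..<n}"
    using inj_s by (simp add: endo_inj_surj)
  define f where "f i = vs ! s i" for i
  have edge: "{f i, f (Suc i)} = e (s i)" for i
    by (simp add: f_def e_def s_def mod_Suc_eq)
  show thesis
  proof
    show "odd n" by fact
    show "f 0 = u" "f n = u"
      using m by (simp_all add: f_def s_def)
    show "inj_on (\<lambda>i. {f i, f (Suc i)}) {..<n}"
      using comp_inj_on[OF inj_s, of e] inj_e by (simp add: edge im_s comp_def)
    show "C = (\<lambda>i. {f i, f (Suc i)}) ` {..<n}"
      unfolding edge C using im_s by (metis image_image)
  qed
qed

text \<open>For odd \<open>k\<close> and \<open>g k = g 0\<close> the value is
  \<open>2 * g 0\<close>: edge sums around an odd closed walk determine the vertex values.\<close>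

lemma alternating_sum_telescope:
  fixes g :: "nat \<Rightarrow> 'a::comm_ring_1"
  shows "(\<Sum>i<k. (-1) ^ i * (g i + g (Suc i))) = g 0 - (-1) ^ k * g k"
  by (induction k) (simp_all add: distrib_left)

text \<open>The alternating sum of the edge values around \<open>C\<close>, started at
  \<open>u\<close>, telescopes to \<open>2 * a u\<close>. Used with \<open>W\<close> zero for
  spanning and with \<open>W\<close> the heights on a cell.\<close>

lemma odd_cycle_potential_bound:
  fixes a :: "'n \<Rightarrow> real"
  assumes C: "odd_cycle E C" and card2: "\<And>e. e \<in> C \<Longrightarrow> card e = 2" and u: "u \<in> cycle_verts C"
    and W: "\<And>e. e \<in> C \<Longrightarrow> (\<Sum>i\<in>e. a i) = W e"
  shows "\<bar>2 * a u\<bar> \<le> (\<Sum>e\<in>C. \<bar>W e\<bar>)"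
proof -
  obtain f k where f: "odd k" "f 0 = u" "f k = u"
    "inj_on (\<lambda>i. {f i, f (Suc i)}) {..<k}" "C = (\<lambda>i. {f i, f (Suc i)}) ` {..<k}"
    using odd_cycle_closed_walk[OF C u] .
  have edge: "a (f i) + a (f (Suc i)) = W {f i, f (Suc i)}" if "i < k" for i
  proof -
    have e: "{f i, f (Suc i)} \<in> C"
      using that f(5) by auto
    then have "f i \<noteq> f (Suc i)"
      using card2[OF e] by auto
    then show ?thesis
      using W[OF e] by simp
  qed
  have "2 * a u = (\<Sum>i<k. (-1) ^ i * (a (f i) + a (f (Suc i))))"
    using f(1-3) alternating_sum_telescope[of "\<lambda>i. a (f i)" k] by simp
  also have "\<bar>\<dots>\<bar> \<le> (\<Sum>i<k. \<bar>(-1) ^ i * (a (f i) + a (f (Suc i)))\<bar>)"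
    by (rule sum_abs)
  also have "\<dots> = (\<Sum>i<k. \<bar>W {f i, f (Suc i)}\<bar>)"
    by (intro sum.cong) (auto simp: abs_mult power_abs edge)
  also have "\<dots> = (\<Sum>e\<in>C. \<bar>W e\<bar>)"
    unfolding f(5) by (simp add: sum.reindex[OF f(4)])
  finally show ?thesis .
qed

lemma odd_cycle_verts_nonempty:
  assumes "odd_cycle E C" "\<And>e. e \<in> C \<Longrightarrow> card e = 2"
  shows "cycle_verts C \<noteq> {}"
proof -
  have "C \<noteq> {}"
    using assms(1) by (auto simp: odd_cycle_def)
  then show ?thesis
    using assms(2) by (fastforce simp: cycle_verts_def)
qed

lemma odd_cycle_subset: "odd_cycle E C \<Longrightarrow> C \<subseteq> E"
  by (simp add: odd_cycle_def cycle_of_def)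

lemma odd_cycle_mono: "odd_cycle F C \<Longrightarrow> F \<subseteq> E \<Longrightarrow> odd_cycle E C"
  by (auto simp: odd_cycle_def cycle_of_def)

text \<open>A shortest odd closed walk is a cycle: a repeated vertex would split it into two closed
  walks, one of them odd and shorter.\<close>

lemma odd_cycle_of_closed_walk:
  assumes F: "simple_graph F" and "odd k" "(u, u) \<in> adj_rel F ^^ k"
  obtains C where "odd_cycle F C" "cycle_verts C \<subseteq> (adj_rel F)\<^sup>* `` {u}"
proof -
  let ?R = "adj_rel F"
  \<comment> \<open>The base point ranges over the component of \<open>u\<close>, because the
    shorter walk may be based at the repeated vertex.\<close>
  define P where "P k \<longleftrightarrow> odd k \<and> (\<exists>x. (u, x) \<in> ?R\<^sup>* \<and> (x, x) \<in> ?R ^^ k)" for k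
  have "P k"
    using assms by (auto simp: P_def)
  define n where "n = (LEAST k. P k)"
  have "P n"
    unfolding n_def using \<open>P k\<close> by (rule LeastI)
  then have "odd n"
    by (simp add: P_def)
  have least: "\<not> P j" if "j < n" for j
    using that not_less_Least unfolding n_def by blast
  obtain x where x: "(u, x) \<in> ?R\<^sup>*" "(x, x) \<in> ?R ^^ n"
    using \<open>P n\<close> by (auto simp: P_def)
  then obtain f where f: "f 0 = x" "f n = x" "\<forall>i<n. (f i, f (Suc i)) \<in> ?R"
    by (auto simp: relpow_fun_conv)
  have reach: "(u, f i) \<in> ?R\<^sup>*" if "i \<le> n" for i
    using relpow_segment[OF f(3), of 0 i] that x(1) f(1)
    by (auto dest!: relpow_imp_rtrancl)
  have distinct: "f i \<noteq> f j" if "i < j" "j < n" for i j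
  proof
    assume eq: "f i = f j"
    have "(f i, f i) \<in> ?R ^^ (j - i)"
      using relpow_segment[OF f(3), of i j] that eq by simp
    moreover have "(f 0, f 0) \<in> ?R ^^ (i + (n - j))"
      using relpow_trans[OF relpow_segment[OF f(3), of 0 i], of "f n" "n - j"]
        relpow_segment[OF f(3), of j n] that eq f(1,2) by simp
    moreover have "odd (j - i) \<or> odd (i + (n - j))"
      using \<open>odd n\<close> that by presburger
    ultimately have "P (j - i) \<or> P (i + (n - j))"
      using reach[of i] reach[of 0] that unfolding P_def by auto
    moreover have "j - i < n" "i + (n - j) < n"
      using that by auto
    ultimately show False
      using least by blast
  qed
  \<comment> \<open>A closed walk of length 1 would be a loop, whose edge set has one element
    only.\<close>
  have "f 0 \<noteq> f 1" if "n = 1"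
    using f(3) F that by (force simp: adj_rel_def simple_graph_def)
  then have "n \<noteq> 1"
    using f(1,2) by auto
  then have n3: "n \<ge> 3"
    using \<open>odd n\<close> by presburger
  define vs where "vs = map f [0..<n]"
  have vs: "distinct vs" "length vs = n"
    using distinct by (auto simp: vs_def distinct_map inj_on_def) (metis nat_neq_iff)
  define C where "C = {{vs ! i, vs ! ((i + 1) mod length vs)} | i. i < length vs}"
  have succ: "vs ! ((i + 1) mod n) = f (Suc i)" if "i < n" for i
    using that f(1,2) by (cases "Suc i = n") (auto simp: vs_def)
  have nth: "vs ! i = f i" if "i < n" for i
    using that by (simp add: vs_def)
  have C: "C = {{f i, f (Suc i)} | i. i < n}"
    unfolding C_def vs(2) using nth succ by (intro Collect_cong) (metis (full_types))
  have "C = (\<lambda>i. {vs ! i, vs ! ((i + 1) mod length vs)}) ` {..<length vs}"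
    by (auto simp: C_def)
  then have "card C = n"
    using inj_on_cycle_edges[OF vs(1)] n3 vs(2) by (simp add: card_image)
  moreover have "C \<subseteq> F"
    using f(3) by (auto simp: C adj_rel_def)
  ultimately have "odd_cycle F C"
    using \<open>odd n\<close> vs n3 unfolding odd_cycle_def cycle_of_def C_def by auto
  moreover have "cycle_verts C \<subseteq> ?R\<^sup>* `` {u}"
    using reach by (fastforce simp: cycle_verts_def C)
  ultimately show thesis
    by (rule that)
qed

section \<open>Edge vectors\<close>

lemma inner_rho: "a \<bullet> rho e = (\<Sum>i\<in>e. a $ i)"
  by (simp add: inner_vec_def rho_def if_distrib sum.If_cases cong: if_cong)

text \<open>Decodes an edge from its vector, so that edge weights can serve as heights of
  points.\<close>

lemma support_rho: "{i. rho e $ i = 1} = e"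
  by (simp add: rho_def)

lemma rho_edge: "u \<noteq> v \<Longrightarrow> rho {u, v} = axis u 1 + axis v 1"
  by (auto simp: rho_def axis_def vec_eq_iff)

lemma half_inner_rho: "card e = 2 \<Longrightarrow> (\<chi> i. 1 / 2) \<bullet> rho e = 1"
  by (simp add: inner_rho)

text \<open>A vector orthogonal to all edge vectors changes sign across every edge. The odd cycle
  forces a zero coordinate, which connectivity spreads to all vertices.\<close>

lemma span_rho_connected:
  assumes E: "simple_graph E" and conn: "connected_graph E" and C: "odd_cycle E C"
  shows "span (rho ` E) = UNIV"
proof (rule ccontr)
  assume "span (rho ` E) \<noteq> UNIV"
  then obtain y where y: "y \<noteq> 0" "\<And>v. v \<in> span (rho ` E) \<Longrightarrow> y \<bullet> v = 0"
    using span_not_UNIV_orthogonal by blast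
  have edge: "(\<Sum>i\<in>e. y $ i) = 0" if "e \<in> E" for e
    using y(2)[of "rho e"] that by (simp add: inner_rho span_base)
  have card2: "card e = 2" if "e \<in> C" for e
    using odd_cycle_subset[OF C] E that by (auto simp: simple_graph_def)
  obtain u where u: "u \<in> cycle_verts C"
    using odd_cycle_verts_nonempty[OF C card2] by auto
  have "\<bar>2 * y $ u\<bar> \<le> (\<Sum>e\<in>C. \<bar>0\<bar>)"
    using odd_cycle_subset[OF C] edge
    by (intro odd_cycle_potential_bound[OF C card2 u]) auto
  then have yu: "y $ u = 0"
    by simp
  have "y $ v = 0" for v
  proof -
    have "(u, v) \<in> (adj_rel E)\<^sup>*"
      using conn by (simp add: connected_graph_def)
    then show ?thesis
    proof induction
      case base
      show ?case by (rule yu)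
    next
      case (step p q)
      then have e: "{p, q} \<in> E"
        by (simp add: adj_rel_def)
      then have "p \<noteq> q"
        using E by (auto simp: simple_graph_def)
      then show ?case
        using edge[OF e] step.IH by simp
    qed
  qed
  then show False
    using y(1) by (simp add: vec_eq_iff)
qed

text \<open>In a bipartite component, the signed indicator of the two colour classes would be
  orthogonal to all edge vectors.\<close>

lemma odd_closed_walk_of_span:
  fixes F :: "'n::finite set set"
  assumes F: "simple_graph F" and span: "span (rho ` F) = UNIV"
  shows "\<exists>k. odd k \<and> (u, u) \<in> adj_rel F ^^ k"
proof (rule ccontr)
  let ?R = "adj_rel F"
  assume no: "\<not> ?thesis"
  \<comment> \<open>\<open>P\<close> and \<open>N\<close> are the colour classes of the component of
    \<open>u\<close>; vertices outside it satisfy neither.\<close>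
  define P where "P v \<longleftrightarrow> (\<exists>k. even k \<and> (u, v) \<in> ?R ^^ k)" for v
  define N where "N v \<longleftrightarrow> (\<exists>k. odd k \<and> (u, v) \<in> ?R ^^ k)" for v
  have excl: "\<not> (P v \<and> N v)" for v
  proof
    assume "P v \<and> N v"
    then obtain j k where "even j" "odd k" "(u, v) \<in> ?R ^^ j" "(u, v) \<in> ?R ^^ k"
      by (auto simp: P_def N_def)
    then have "(u, u) \<in> ?R ^^ (j + k)" "odd (j + k)"
      by (simp_all add: relpow_trans[OF _ relpow_sym[OF sym_adj_rel]])
    with no show False
      by blast
  qed
  have step: "(P p \<longrightarrow> N q) \<and> (N p \<longrightarrow> P q)" if "(p, q) \<in> ?R" for p q
    using that unfolding P_def N_def by (meson even_Suc relpow_Suc_I)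
  define y :: "real ^ 'n" where "y = (\<chi> v. if P v then 1 else if N v then - 1 else 0)"
  have "y \<bullet> rho e = 0" if "e \<in> F" for e
  proof -
    obtain p q where e: "e = {p, q}" "p \<noteq> q"
      using F \<open>e \<in> F\<close> by (auto simp: simple_graph_def card_2_iff)
    then have "(p, q) \<in> ?R" "(q, p) \<in> ?R"
      using \<open>e \<in> F\<close> by (auto simp: adj_rel_def insert_commute)
    then have "P p \<longleftrightarrow> N q" "N p \<longleftrightarrow> P q"
      using step by blast+
    then show ?thesis
      using e excl[of p] excl[of q] by (auto simp: inner_rho y_def)
  qed
  then have "orthogonal y v" if "v \<in> span (rho ` F)" for v
    by (intro orthogonal_to_span[OF that]) (auto simp: orthogonal_def)
  then have "y = 0"
    using span orthogonal_self[of y] by simp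
  then have "y $ u = 0"
    by simp
  moreover have "P u"
    unfolding P_def by (intro exI[of _ 0]) simp
  ultimately show False
    by (simp add: y_def)
qed

text \<open>The components of \<open>u\<close> and \<open>v\<close> contain odd cycles, which meet,
  so the two vertices are joined by a walk. If its length is even, an odd closed walk at
  \<open>u\<close> is prepended.\<close>

lemma odd_walk_of_no_disjoint_odd_cycles:
  fixes F :: "'n::finite set set"
  assumes F: "simple_graph F" and span: "span (rho ` F) = UNIV"
    and meet: "\<And>C C'. odd_cycle F C \<Longrightarrow> odd_cycle F C' \<Longrightarrow> cycle_verts C \<inter> cycle_verts C' \<noteq> {}"
  shows "\<exists>k. odd k \<and> (u, v) \<in> adj_rel F ^^ k"
proof -
  let ?R = "adj_rel F"
  obtain j where j: "odd j" "(u, u) \<in> ?R ^^ j"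
    using odd_closed_walk_of_span[OF F span] by blast
  obtain j' where j': "odd j'" "(v, v) \<in> ?R ^^ j'"
    using odd_closed_walk_of_span[OF F span] by blast
  obtain C where C: "odd_cycle F C" "cycle_verts C \<subseteq> ?R\<^sup>* `` {u}"
    using odd_cycle_of_closed_walk[OF F j] .
  obtain C' where C': "odd_cycle F C'" "cycle_verts C' \<subseteq> ?R\<^sup>* `` {v}"
    using odd_cycle_of_closed_walk[OF F j'] .
  obtain x where "(u, x) \<in> ?R\<^sup>*" "(v, x) \<in> ?R\<^sup>*"
    using meet[OF C(1) C'(1)] C(2) C'(2) by blast
  then have "(u, v) \<in> ?R\<^sup>*"
    using sym_adj_rel by (meson rtrancl_trans sym_rtrancl symD)
  then obtain k where k: "(u, v) \<in> ?R ^^ k"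
    using rtrancl_imp_relpow by blast
  show ?thesis
  proof (cases "odd k")
    case False
    then have "odd (j + k)"
      using j(1) by simp
    with relpow_trans[OF j(2) k] show ?thesis
      by blast
  qed (use k in blast)
qed

section \<open>Unimodularity\<close>

text \<open>For finite \<open>S\<close> this is the subgroup generated by \<open>S\<close>, with
  coefficients in the form used by \<open>unimodular_simplex\<close>.\<close>

definition int_span :: "'a::real_vector set \<Rightarrow> 'a set" where
  "int_span S = range (\<lambda>c :: 'a \<Rightarrow> int. \<Sum>v\<in>S. of_int (c v) *\<^sub>R v)"

lemma int_span_base:
  assumes "finite S" "v \<in> S"
  shows "v \<in> int_span S"
proof -
  have "(\<Sum>x\<in>S. of_int (if x = v then 1 else 0) *\<^sub>R x) = (\<Sum>x\<in>S. if x = v then v else 0)"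
    by (intro sum.cong) auto
  also have "\<dots> = v"
    using assms by simp
  finally show ?thesis
    unfolding int_span_def by (intro range_eqI[of v _ "\<lambda>x. if x = v then 1 else 0"]) (rule sym)
qed

lemma int_span_add: "x \<in> int_span S \<Longrightarrow> y \<in> int_span S \<Longrightarrow> x + y \<in> int_span S"
proof (unfold int_span_def, elim rangeE)
  fix c d :: "'a \<Rightarrow> int"
  assume "x = (\<Sum>v\<in>S. of_int (c v) *\<^sub>R v)" "y = (\<Sum>v\<in>S. of_int (d v) *\<^sub>R v)"
  then have "x + y = (\<Sum>v\<in>S. of_int (c v + d v) *\<^sub>R v)"
    by (simp add: scaleR_add_left sum.distrib)
  then show "x + y \<in> range (\<lambda>c :: 'a \<Rightarrow> int. \<Sum>v\<in>S. of_int (c v) *\<^sub>R v)"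
    by (rule range_eqI[of _ _ "\<lambda>v. c v + d v"])
qed

lemma int_span_scale: "x \<in> int_span S \<Longrightarrow> of_int m *\<^sub>R x \<in> int_span S"
proof (unfold int_span_def, elim rangeE)
  fix c :: "'a \<Rightarrow> int"
  assume "x = (\<Sum>v\<in>S. of_int (c v) *\<^sub>R v)"
  then have "of_int m *\<^sub>R x = (\<Sum>v\<in>S. of_int (m * c v) *\<^sub>R v)"
    by (simp add: scaleR_sum_right)
  then show "of_int m *\<^sub>R x \<in> range (\<lambda>c :: 'a \<Rightarrow> int. \<Sum>v\<in>S. of_int (c v) *\<^sub>R v)"
    by (rule range_eqI[of _ _ "\<lambda>v. m * c v"])
qed

lemma int_span_diff: "x \<in> int_span S \<Longrightarrow> y \<in> int_span S \<Longrightarrow> x - y \<in> int_span S"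
  using int_span_add[of x S "- y"] int_span_scale[of y S "- 1"] by simp

lemma int_span_sum:
  assumes "\<And>i. i \<in> I \<Longrightarrow> f i \<in> int_span S"
  shows "sum f I \<in> int_span S"
proof -
  have "0 \<in> int_span S"
    unfolding int_span_def by (rule range_eqI[of _ _ "\<lambda>_. 0"]) simp
  with assms show ?thesis
    by (induction I rule: infinite_finite_induct) (auto intro: int_span_add)
qed

text \<open>The alternating sum of edge vectors along the walk telescopes; odd length gives
  \<open>axis u 1 + axis v 1\<close>.\<close>

lemma int_span_walk:
  fixes F :: "'n::finite set set"
  assumes F: "simple_graph F" and "(u, v) \<in> adj_rel F ^^ k"
  shows "axis u 1 - (- 1) ^ k *\<^sub>R axis v 1 \<in> int_span (rho ` F)"
  using assms(2)
proof (induction k arbitrary: v)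
  case 0
  then show ?case
    using int_span_sum[of "{}"] by simp
next
  case (Suc k)
  then obtain p where p: "(u, p) \<in> adj_rel F ^^ k" "{p, v} \<in> F"
    by (auto simp: adj_rel_def)
  then have "p \<noteq> v"
    using F by (auto simp: simple_graph_def)
  have "of_int ((- 1) ^ k) *\<^sub>R rho {p, v} \<in> int_span (rho ` F)"
    using p(2) by (intro int_span_scale int_span_base) auto
  from int_span_add[OF Suc.IH[OF p(1)] this] show ?case
    using \<open>p \<noteq> v\<close> by (simp add: rho_edge scaleR_add_right)
qed

lemma unimodular_simplex_rho:
  fixes F :: "'n::finite set set"
  assumes F: "simple_graph F" and walk: "\<And>u v. \<exists>k. odd k \<and> (u, v) \<in> adj_rel F ^^ k"
  shows "unimodular_simplex (rho ` F)"
  unfolding unimodular_simplex_def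
proof (intro allI impI, elim conjE)
  fix z :: "real ^ 'n"
  assume z: "integral_point z" "z \<in> affine hull (rho ` F)"
  let ?h = "(\<chi> i. 1 / 2) :: real ^ 'n"
  have hF: "?h \<bullet> v = 1" if "v \<in> rho ` F" for v
    using F that half_inner_rho by (auto simp: simple_graph_def)
  have "affine hull (rho ` F) \<subseteq> {x. ?h \<bullet> x = 1}"
    using hF by (intro hull_minimal affine_hyperplane) auto
  then have hz: "?h \<bullet> z = 1"
    using z(2) by auto
  moreover have "?h \<bullet> z = (\<Sum>i\<in>UNIV. z $ i) / 2"
    unfolding sum_divide_distrib inner_vec_def by (intro sum.cong) auto
  ultimately have sum_z: "(\<Sum>i\<in>UNIV. z $ i) = 2"
    by simp
  have "\<forall>i. \<exists>k. z $ i = of_int k"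
    using z(1) by (auto simp: integral_point_def elim: Ints_cases)
  then obtain m :: "'n \<Rightarrow> int" where m: "\<And>i. z $ i = of_int (m i)"
    by metis
  obtain u :: 'n where "u \<in> UNIV"
    by blast
  have pair: "axis i 1 + axis u 1 \<in> int_span (rho ` F)" for i :: 'n
  proof -
    obtain k where "odd k" "(i, u) \<in> adj_rel F ^^ k"
      using walk by blast
    then show ?thesis
      using int_span_walk[OF F, of i u k] by simp
  qed
  have "z = (\<Sum>i\<in>UNIV. z $ i *\<^sub>R axis i 1)"
    using basis_expansion[of z, symmetric] unfolding scalar_mult_eq_scaleR .
  \<comment> \<open>The coordinates of \<open>z\<close> sum to 2, so the correction is twice
    \<open>axis u 1\<close>, itself the instance \<open>i = u\<close> of
    \<open>pair\<close>.\<close>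
  also have "\<dots> = (\<Sum>i\<in>UNIV. z $ i *\<^sub>R (axis i 1 + axis u 1)) - (\<Sum>i\<in>UNIV. z $ i) *\<^sub>R axis u 1"
    by (simp only: scaleR_add_right sum.distrib scaleR_sum_left add_diff_cancel_right')
  also have "\<dots> = (\<Sum>i\<in>UNIV. of_int (m i) *\<^sub>R (axis i 1 + axis u 1)) - (axis u 1 + axis u 1)"
    unfolding sum_z scaleR_2 by (simp only: m)
  also have "\<dots> \<in> int_span (rho ` F)"
    by (intro int_span_diff int_span_sum int_span_scale pair)
  finally obtain c :: "real ^ 'n \<Rightarrow> int" where c: "z = (\<Sum>v\<in>rho ` F. of_int (c v) *\<^sub>R v)"
    by (auto simp: int_span_def)
  \<comment> \<open>\<open>?h\<close> is 1 on every edge vector, so pairing with it reads off the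
    coefficient sum.\<close>
  have "of_int (sum c (rho ` F)) = ?h \<bullet> z"
    unfolding c inner_sum_right inner_scaleR_right of_int_sum by (intro sum.cong) (auto simp: hF)
  then have "sum c (rho ` F) = 1"
    by (simp only: hz of_int_eq_1_iff)
  with c show "\<exists>c :: real ^ 'n \<Rightarrow> int. sum c (rho ` F) = 1 \<and> (\<Sum>v\<in>rho ` F. of_int (c v) *\<^sub>R v) = z"
    by metis
qed

section \<open>Heights determined by the chosen bridges\<close>

text \<open>With two other bridges on the walk, at most one of them is special: 3/2 + 1 + 1/2 = 2 *
  3/2. Otherwise there is at most one: 3/2 + 1/2 = 2 * 1. The slack 1/2 leaves room for the generic
  perturbation.\<close>

lemma bridge_weights:
  fixes b :: "'n::finite set set set \<Rightarrow> 'n set" and PP :: "'n set set set set"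
  defines "N \<equiv> \<lambda>Pr. walk_edges Pr (b Pr) \<inter> (b ` PP - {b Pr})"
  assumes le2: "\<forall>Pr\<in>PP. card (N Pr) \<le> 2" and special: "card {Pr\<in>PP. card (N Pr) = 2} \<le> 2"
  obtains x :: "'n set \<Rightarrow> real" where "\<And>e. x e \<ge> 0"
    "\<And>Pr. Pr \<in> PP \<Longrightarrow> sum x (N Pr) + 1 / 2 \<le> 2 * x (b Pr)"
proof -
  define Sp where "Sp = b ` {Pr\<in>PP. card (N Pr) = 2}"
  have cardSp: "card Sp \<le> 2"
    unfolding Sp_def using special card_image_le[of "{Pr\<in>PP. card (N Pr) = 2}" b] by simp
  define x :: "'n set \<Rightarrow> real" where "x e = (if e \<in> Sp then 3 / 2 else 1)" for e
  show thesis
  proof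
    show "x e \<ge> 0" for e
      by (simp add: x_def)
    fix Pr assume Pr: "Pr \<in> PP"
    have "sum x (N Pr) = (\<Sum>e\<in>N Pr. 1 + (if e \<in> Sp then 1 / 2 else 0))"
      by (intro sum.cong) (auto simp: x_def)
    also have "\<dots> = card (N Pr) + card (N Pr \<inter> Sp) / 2"
      by (simp add: sum.distrib sum.inter_restrict[symmetric])
    finally have sum_x: "sum x (N Pr) = card (N Pr) + card (N Pr \<inter> Sp) / 2" .
    show "sum x (N Pr) + 1 / 2 \<le> 2 * x (b Pr)"
    proof (cases "card (N Pr) = 2")
      case True
      then have bS: "b Pr \<in> Sp"
        using Pr by (auto simp: Sp_def)
      have "N Pr \<inter> Sp \<subseteq> Sp - {b Pr}"
        by (auto simp: N_def)
      then have "card (N Pr \<inter> Sp) \<le> card (Sp - {b Pr})"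
        by (intro card_mono) auto
      also have "\<dots> \<le> 1"
        using bS cardSp by (simp add: card_Diff_singleton)
      finally have "card (N Pr \<inter> Sp) \<le> 1" .
      moreover have "x (b Pr) = 3 / 2"
        using bS by (simp add: x_def)
      ultimately show ?thesis
        using True by (simp add: sum_x)
    next
      case False
      then have "card (N Pr) \<le> 1"
        using le2 Pr by force
      moreover have "card (N Pr \<inter> Sp) \<le> card (N Pr)"
        by (intro card_mono) auto
      \<comment> \<open>Only an inequality: \<open>b Pr\<close> may be special through another pair
        with the same bridge.\<close>
      moreover have "x (b Pr) \<ge> 1"
        by (simp add: x_def)
      ultimately show ?thesis
        by (simp add: sum_x)
    qed
  qed
qed

theorem theorem2p1:
  fixes E :: "'n::finite set set"
    and b :: "'n set set set \<Rightarrow> 'n set"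
  assumes "simple_graph E"
    and "connected_graph E"
    and "fundamental_FHM E"
    and "\<forall>Pr\<in>odd_pairs E. is_bridge E Pr (b Pr)"
    and "\<forall>Pr\<in>odd_pairs E.
           card (walk_edges Pr (b Pr) \<inter> (b ` odd_pairs E - {b Pr})) \<le> 2"
    and "card {Pr\<in>odd_pairs E.
           card (walk_edges Pr (b Pr) \<inter> (b ` odd_pairs E - {b Pr})) = 2} \<le> 2"
  shows "has_regular_unimodular_triangulation E"
proof -
  define B where "B = b ` odd_pairs E"
  define A where "A = rho ` E"
  have card2: "card e = 2" if "e \<in> E" for e
    using assms(1) that by (simp add: simple_graph_def)
  obtain C0 where "odd_cycle E C0"
    using assms(3) by (auto simp: fundamental_FHM_def odd_pairs_def)
  then have span: "span A = UNIV"
    unfolding A_def by (rule span_rho_connected[OF assms(1,2)])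
  obtain x :: "'n set \<Rightarrow> real" where x0: "\<And>e. x e \<ge> 0"
    and x: "\<And>Pr. Pr \<in> odd_pairs E \<Longrightarrow>
      sum x (walk_edges Pr (b Pr) \<inter> (B - {b Pr})) + 1 / 2 \<le> 2 * x (b Pr)"
    unfolding B_def using bridge_weights[OF assms(5,6)] by metis
  define W0 where "W0 e = (if e \<in> B then - x e else 0)" for e
  \<comment> \<open>The errors total at most \<open>card E\<close> times \<delta> on the cycles plus
    2 \<delta> on the doubled bridge, that is 1/4, below the slack 1/2.\<close>
  define \<delta> :: real where "\<delta> = 1 / (4 * (card E + 2))"
  have "\<delta> > 0"
    by (simp add: \<delta>_def)
  have "finite A"
    by (simp add: A_def)
  obtain w where w: "\<forall>v\<in>A. \<bar>w v - W0 {i. v $ i = 1}\<bar> < \<delta>"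
    and gen: "\<And>D a. D \<subseteq> A \<Longrightarrow> \<forall>v\<in>D. a \<bullet> v = w v \<Longrightarrow> independent D"
    using generic_height[OF \<open>finite A\<close> \<open>\<delta> > 0\<close>, where ?w0.0 = "\<lambda>v. W0 {i. v $ i = 1}"] by blast
  define W where "W e = w (rho e)" for e
  have W: "\<bar>W e - W0 e\<bar> < \<delta>" if "e \<in> E" for e
    using w that by (simp add: W_def A_def support_rho)
  have "regular_triangulation A (lower_cells A w)"
  proof (rule regular_triangulation_lower_cells[OF \<open>finite A\<close> span _ gen])
    show "(\<chi> i. 1 / 2) \<bullet> v = 1" if "v \<in> A" for v
      using that card2 half_inner_rho by (auto simp: A_def)
  qed
  moreover have "unimodular_simplex S" if cell: "S \<in> lower_cells A w" for S
  proof -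
    obtain a where S: "S = tight A w a" and a: "a \<in> dual_feasible A w" and spS: "span S = UNIV"
      using cell by (auto simp: lower_cells_def)
    define F where "F = {e \<in> E. a \<bullet> rho e = w (rho e)}"
    have S_F: "S = rho ` F"
      unfolding S F_def tight_def A_def by blast
    have F: "simple_graph F" "F \<subseteq> E"
      using assms(1) by (auto simp: F_def simple_graph_def)
    have meet: "cycle_verts C \<inter> cycle_verts C' \<noteq> {}"
      if C: "odd_cycle F C" "odd_cycle F C'" for C C'
    proof
      assume disj: "cycle_verts C \<inter> cycle_verts C' = {}"
      define Pr where "Pr = {C, C'}"
      have Pr: "Pr \<in> odd_pairs E"
        using C disj odd_cycle_mono[OF _ F(2)] by (auto simp: odd_pairs_def Pr_def)
      then have "is_bridge E Pr (b Pr)"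
        using assms(4) by blast
      \<comment> \<open>\<open>D\<close> and \<open>D'\<close> are \<open>C\<close> and
        \<open>C'\<close> in the order in which the bridge meets them.\<close>
      then obtain D D' u v where D: "Pr = {D, D'}" "u \<in> cycle_verts D" "v \<in> cycle_verts D'"
          "b Pr = {u, v}" and bE: "b Pr \<in> E"
        unfolding is_bridge_def by blast
      have odd: "odd_cycle F D" "odd_cycle F D'" and disjD: "cycle_verts D \<inter> cycle_verts D' = {}"
        using C disj D(1) by (auto simp: Pr_def doubleton_eq_iff)
      have DF: "D \<subseteq> F" "D' \<subseteq> F"
        using odd odd_cycle_subset by auto
      then have DE: "D \<union> D' \<subseteq> E"
        using F(2) by blast
      have bound: "\<bar>2 * a $ p\<bar> \<le> (\<Sum>e\<in>K. \<bar>W e\<bar>)"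
        if "odd_cycle F K" "p \<in> cycle_verts K" for p K
      proof (rule odd_cycle_potential_bound[OF that(1) _ that(2)])
        fix e assume "e \<in> K"
        then have e: "e \<in> F"
          using odd_cycle_subset[OF that(1)] by blast
        then show "card e = 2"
          using F(2) card2 by blast
        show "(\<Sum>i\<in>e. a $ i) = W e"
          using e by (simp add: F_def W_def inner_rho)
      qed
      have "u \<noteq> v"
        using D(2,3) disjD by blast
      then have "a $ u + a $ v = a \<bullet> rho (b Pr)"
        unfolding inner_rho D(4) by simp
      also have "\<dots> \<le> W (b Pr)"
        using a bE by (auto simp: dual_feasible_def A_def W_def)
      finally have "a $ u + a $ v \<le> W (b Pr)" .
      moreover have "D \<inter> D' = {}"
      proof (rule ccontr)
        assume "D \<inter> D' \<noteq> {}"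
        then obtain e where e: "e \<in> D" "e \<in> D'"
          by blast
        then have "e \<noteq> {}"
          using DE card2[of e] by auto
        then show False
          using e disjD by (auto simp: cycle_verts_def)
      qed
      then have "(\<Sum>e\<in>D. \<bar>W e\<bar>) + (\<Sum>e\<in>D'. \<bar>W e\<bar>) = (\<Sum>e\<in>D \<union> D'. \<bar>W e\<bar>)"
        by (simp add: sum.union_disjoint)
      \<comment> \<open>The cycle bounds limit \<open>a $ u\<close> and \<open>a $ v\<close> from
        below, and feasibility at the bridge limits their sum from above.\<close>
      ultimately have lower: "- (\<Sum>e\<in>D \<union> D'. \<bar>W e\<bar>) \<le> 2 * W (b Pr)"
        using bound[OF odd(1) D(2)] bound[OF odd(2) D(3)] by linarith
      have "\<bar>W e\<bar> \<le> (if e \<in> B then x e else 0) + \<delta>" if "e \<in> D \<union> D'" for e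
        using W[of e] DE that x0[of e] by (auto simp: W0_def)
      then have "(\<Sum>e\<in>D \<union> D'. \<bar>W e\<bar>) \<le> (\<Sum>e\<in>D \<union> D'. (if e \<in> B then x e else 0) + \<delta>)"
        by (rule sum_mono)
      also have "\<dots> = sum x ((D \<union> D') \<inter> B) + card (D \<union> D') * \<delta>"
        by (simp add: sum.distrib sum.inter_restrict)
      \<comment> \<open>The bridge has an endpoint on each of the disjoint cycles, so it is an edge
        of neither.\<close>
      also have "(D \<union> D') \<inter> B = walk_edges Pr (b Pr) \<inter> (B - {b Pr})"
      proof -
        have "b Pr \<notin> D \<union> D'"
          using D disjD by (auto simp: cycle_verts_def)
        then show ?thesis
          by (auto simp: walk_edges_def D(1))
      qed
      finally have upper: "(\<Sum>e\<in>D \<union> D'. \<bar>W e\<bar>)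
          \<le> sum x (walk_edges Pr (b Pr) \<inter> (B - {b Pr})) + card (D \<union> D') * \<delta>" .
      have "card (D \<union> D') * \<delta> \<le> card E * \<delta>"
        using DE \<open>\<delta> > 0\<close> by (intro mult_right_mono) (auto intro: card_mono)
      moreover have "(card E + 2) * \<delta> = 1 / 4"
        by (simp add: \<delta>_def field_simps)
      then have "card E * \<delta> + 2 * \<delta> = 1 / 4"
        by (simp add: distrib_right)
      moreover have "W (b Pr) \<le> - x (b Pr) + \<delta>"
        using W[OF bE] Pr by (simp add: W0_def B_def)
      \<comment> \<open>Together the bounds give \<open>2 * x (b Pr)\<close> at most the weight of
        the other chosen bridges on the walk plus 1/4, against the slack 1/2.\<close>
      ultimately show False
        using x[OF Pr] lower upper by linarith
    qed
    show ?thesis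
      unfolding S_F
      using odd_walk_of_no_disjoint_odd_cycles[OF F(1) _ meet] spS S_F
      by (intro unimodular_simplex_rho[OF F(1)]) auto
  qed
  ultimately show ?thesis
    unfolding has_regular_unimodular_triangulation_def A_def by blast
qed

end
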